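(* Let $n\ge 1$ and $j\ge 1$ be integers, and let $0\le d_1<\dots<d_k<q$ be integers such that the ellipsephic set $\mathcal{E}_q^{\{d_1,\dots,d_k\}}$ has no carryover, i.e. $n d_k<q$. Then $$A_{2n,1}\big([\mathcal{E}_q^{\{d_1,\dots,d_k\}}]_j\big)=A_{2n,1}\big([\mathcal{E}_q^{\{d_1,\dots,d_k\}}]_1\big)^j.$$
   Context: For integers $0\le d_1<\dots<d_k<q$ and $j\ge1$, $[\mathcal{E}_q^{\{d_1,\dots,d_k\}}]_j$ is the set of integers of the form $\sum_{s=0}^{j-1}a_sq^s$ with all $a_s\in\{d_1,\dots,d_k\}$; the ellipsephic set $\mathcal{E}_q^{\{d_1,\dots,d_k\}}$ is the union of these over $j\geq 1$. For $S\subset\mathbb{Z}^m$, $A_{p,m}(S)$ is the best constant such that $$\Big\|\sum_{\ell\in S}a(\ell)e(\ell\cdot x)\Big\|_{L^p([0,1]^m)}\le A_{p,m}(S)\Big(\sum_{\ell\in S}|a(\ell)|^2\Big)^{1/2}$$ for all $a:S\to\mathbb{R}_{\ge0}$, where $e(t)=e^{2\pi i t}$. *)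

theory Defs
  imports "HOL-Analysis.Analysis"
begin

definition ellipsephic_level :: "int \<Rightarrow> int set \<Rightarrow> nat \<Rightarrow> int set" where
  "ellipsephic_level q D j = {\<Sum>s<j. a s * q ^ s |a. \<forall>s<j. a s \<in> D}"

definition e_char :: "real \<Rightarrow> complex" where
  "e_char t = exp (2 * complex_of_real pi * \<i> * complex_of_real t)"

definition Lp_norm_cube :: "real \<Rightarrow> ('a::euclidean_space \<Rightarrow> complex) \<Rightarrow> real" where
  "Lp_norm_cube p f = (LINT x:cbox 0 One|lborel. norm (f x) powr p) powr (1 / p)"

text \<open>The dimension \<open>m\<close> is \<open>DIM('a)\<close>, and \<open>S\<close> is a finite set of integer points, regarded as points
  of the Euclidean space \<open>'a\<close>; for \<open>m = 1\<close> the space is \<open>real\<close> and \<open>S\<close> is a finite subset of \<open>\<int>\<close>.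
  The condition \<open>0 \<le> C\<close> only matters for empty \<open>S\<close>. For finite \<open>S\<close> the infimum is a minimum,
  see \<open>best_const_least\<close> below; for infinite \<open>S\<close> the value is meaningless.\<close>

definition admissible_const :: "real \<Rightarrow> ('a::euclidean_space) set \<Rightarrow> real \<Rightarrow> bool" where
  "admissible_const p S C \<longleftrightarrow> 0 \<le> C \<and>
     (\<forall>a :: 'a \<Rightarrow> real. (\<forall>l\<in>S. 0 \<le> a l) \<longrightarrow>
        Lp_norm_cube p (\<lambda>x. \<Sum>l\<in>S. complex_of_real (a l) * e_char (l \<bullet> x))
          \<le> C * (\<Sum>l\<in>S. \<bar>a l\<bar>\<^sup>2) powr (1 / 2))"

definition best_const :: "real \<Rightarrow> ('a::euclidean_space) set \<Rightarrow> real" where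
  "best_const p S = Inf {C. admissible_const p S C}"

lemma finite_ellipsephic_level:
  assumes "finite D"
  shows "finite (ellipsephic_level q D j)"
proof -
  have "ellipsephic_level q D j \<subseteq> (\<lambda>a. \<Sum>s<j. a s * q ^ s) ` (PiE {..<j} (\<lambda>_. D))"
  proof
    fix x assume "x \<in> ellipsephic_level q D j"
    then obtain a where a: "x = (\<Sum>s<j. a s * q ^ s)" "\<forall>s<j. a s \<in> D"
      by (auto simp: ellipsephic_level_def)
    have "x = (\<Sum>s<j. restrict a {..<j} s * q ^ s)"
      unfolding a(1) by (intro sum.cong) auto
    moreover have "restrict a {..<j} \<in> PiE {..<j} (\<lambda>_. D)"
      using a(2) by auto
    ultimately show "x \<in> (\<lambda>a. \<Sum>s<j. a s * q ^ s) ` (PiE {..<j} (\<lambda>_. D))"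
      by blast
  qed
  thus ?thesis
    using assms by (meson finite_PiE finite_imageI finite_lessThan finite_subset)
qed

lemma Lp_norm_cube_le:
  fixes f :: "'a::euclidean_space \<Rightarrow> complex"
  assumes "0 < p" "0 \<le> B" "continuous_on UNIV f" "\<And>x. norm (f x) \<le> B"
  shows "Lp_norm_cube p f \<le> B"
proof -
  have c: "continuous_on (cbox 0 One) (\<lambda>x. norm (f x) powr p)"
    using assms(1) by (intro continuous_on_powr' continuous_intros continuous_on_subset[OF assms(3)]) auto
  have i1: "set_integrable lborel (cbox 0 One :: 'a set) (\<lambda>x. norm (f x) powr p)"
    by (rule borel_integrable_compact[OF _ c, folded set_integrable_def]) auto
  have i2: "set_integrable lborel (cbox 0 One :: 'a set) (\<lambda>x. B powr p)"
    by (rule borel_integrable_compact[folded set_integrable_def]) auto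
  have "(LINT x:(cbox 0 One :: 'a set)|lborel. norm (f x) powr p)
         \<le> (LINT x:(cbox 0 One :: 'a set)|lborel. B powr p)"
    by (rule set_integral_mono[OF i1 i2]) (use assms in \<open>auto intro: powr_mono2\<close>)
  also have "\<dots> = B powr p"
    by (simp add: set_lebesgue_integral_def content_unit)
  finally have "Lp_norm_cube p f \<le> (B powr p) powr (1 / p)"
    unfolding Lp_norm_cube_def using assms(1)
    by (intro powr_mono2) (auto simp: set_lebesgue_integral_def intro!: integral_nonneg_AE)
  thus ?thesis using assms by (simp add: powr_powr)
qed

lemma best_const_least:
  fixes S :: "('a::euclidean_space) set"
  assumes "finite S" "0 < p"
  shows "admissible_const p S (best_const p S)"
    and "admissible_const p S C \<Longrightarrow> best_const p S \<le> C"
proof -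
  let ?A = "{C. admissible_const p S C}"
  let ?f = "\<lambda>(a :: 'a \<Rightarrow> real) x. \<Sum>l\<in>S. complex_of_real (a l) * e_char (l \<bullet> x)"
  let ?r = "\<lambda>a :: 'a \<Rightarrow> real. (\<Sum>l\<in>S. \<bar>a l\<bar>\<^sup>2) powr (1 / 2)"
  have bdd: "bdd_below ?A"
    by (intro bdd_belowI[of _ 0]) (auto simp: admissible_const_def)
  have "Lp_norm_cube p (?f a) \<le> real (card S) * ?r a" for a
  proof (rule Lp_norm_cube_le[OF assms(2)])
    show "0 \<le> real (card S) * ?r a" by simp
    show "continuous_on UNIV (?f a)"
      unfolding e_char_def by (intro continuous_intros)
    fix x
    have "norm (?f a x) \<le> (\<Sum>l\<in>S. ?r a)"
    proof (rule order.trans[OF norm_sum], rule sum_mono)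
      fix l assume "l \<in> S"
      hence "\<bar>a l\<bar>\<^sup>2 \<le> (\<Sum>l\<in>S. \<bar>a l\<bar>\<^sup>2)"
        by (intro member_le_sum) (use assms in auto)
      hence "sqrt (\<bar>a l\<bar>\<^sup>2) \<le> ?r a"
        by (simp add: powr_half_sqrt sum_nonneg flip: real_sqrt_abs)
      thus "norm (complex_of_real (a l) * e_char (l \<bullet> x)) \<le> ?r a"
        by (simp add: e_char_def norm_mult)
    qed
    thus "norm (?f a x) \<le> real (card S) * ?r a" by simp
  qed
  hence ne: "?A \<noteq> {}" by (auto simp: admissible_const_def intro!: exI[of _ "real (card S)"])
  show "admissible_const p S C \<Longrightarrow> best_const p S \<le> C"
    unfolding best_const_def using bdd by (intro cInf_lower) auto
  have "Lp_norm_cube p (?f a) \<le> best_const p S * ?r a" if a: "\<forall>l\<in>S. 0 \<le> a l" for a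
  proof -
    have *: "Lp_norm_cube p (?f a) \<le> C * ?r a" if "C \<in> ?A" for C
      using that a by (auto simp: admissible_const_def)
    show ?thesis
    proof (cases "?r a = 0")
      case True
      thus ?thesis using ne * by (metis (no_types, lifting) ex_in_conv mult_zero_right)
    next
      case False
      hence r: "?r a > 0" by (metis order_le_less powr_ge_zero)
      have "Lp_norm_cube p (?f a) / ?r a \<le> Inf ?A"
        using ne by (rule cInf_greatest) (use * r in \<open>auto simp: divide_le_eq\<close>)
      thus ?thesis using r unfolding best_const_def by (simp add: divide_le_eq)
    qed
  qed
  moreover have "0 \<le> best_const p S"
    unfolding best_const_def using ne by (intro cInf_greatest) (auto simp: admissible_const_def)
  ultimately show "admissible_const p S (best_const p S)"
    by (simp add: admissible_const_def)
qed

end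

theory Submission
  imports Defs
begin

text \<open>
  Expanding the even power writes the \<open>2n\<close>-th moment of an exponential sum as a count of coincidences
  between \<open>n\<close>-fold sums of frequencies. Without carryover, two \<open>n\<close>-fold sums of elements of \<open>A + q B\<close>
  agree iff their \<open>A\<close>-parts and their \<open>B\<close>-parts agree, so on \<open>A + q B\<close> the moment equals the
  iterated moment over \<open>[0,1]\<^sup>2\<close> of the sum with frequencies \<open>(a, b)\<close>. Bounding the inner integral
  by the constant of \<open>A\<close>, applying Minkowski's inequality in \<open>L\<^sup>n\<close> and then the constant of \<open>B\<close> gives
  the upper bound, and tensor products of coefficients give the lower bound. Hence the best constant
  is multiplicative, and the theorem follows by splitting off one digit at a time.
\<close>

section \<open>Characters and their orthogonality on the unit interval\<close>

lemma e_char_0 [simp]: "e_char 0 = 1"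
  by (simp add: e_char_def)

lemma e_char_add: "e_char (s + t) = e_char s * e_char t"
  by (simp add: e_char_def distrib_left exp_add)

lemma cnj_e_char: "cnj (e_char t) = e_char (- t)"
  by (simp add: e_char_def exp_cnj)

lemma e_char_diff: "e_char (s - t) = e_char s * cnj (e_char t)"
  using e_char_add[of s "- t"] by (simp add: cnj_e_char)

lemma e_char_sum: "finite I \<Longrightarrow> e_char (\<Sum>i\<in>I. f i) = (\<Prod>i\<in>I. e_char (f i))"
  by (induction I rule: finite_induct) (auto simp: e_char_add)

lemma e_char_of_int: "e_char (of_int m) = 1"
  using exp_integer_2pi[of "of_int m"] by (simp add: e_char_def mult_ac)

lemma continuous_on_e_char [continuous_intros]:
  "continuous_on A f \<Longrightarrow> continuous_on A (\<lambda>x. e_char (f x))"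
  unfolding e_char_def by (intro continuous_intros)

lemma has_integral_e_char:
  "((\<lambda>x. e_char (of_int m * x)) has_integral (if m = 0 then 1 else 0)) {0..1}"
proof (cases "m = 0")
  case True
  thus ?thesis using has_integral_const_real[of "1::complex" 0 1] by simp
next
  case False
  define w where "w = 2 * complex_of_real pi * \<i> * of_int m"
  have w: "w \<noteq> 0" using False by (simp add: w_def)
  have e: "e_char (of_int m * x) = exp (w * of_real x)" for x
    by (simp add: e_char_def w_def mult_ac)
  have "((\<lambda>x. exp (w * of_real x)) has_integral
          (exp (w * of_real 1) / w - exp (w * of_real 0) / w)) {0..1}"
  proof (rule fundamental_theorem_of_calculus)
    fix x :: real
    have "((\<lambda>z. exp (w * z) / w) has_field_derivative exp (w * of_real x)) (at (of_real x))"
      using w by (auto intro!: derivative_eq_intros)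
    from has_vector_derivative_real_field[OF this]
    show "((\<lambda>x. exp (w * of_real x) / w) has_vector_derivative exp (w * of_real x))
            (at x within {0..1})" .
  qed simp
  \<comment> \<open>The antiderivative has period 1, so its endpoint values cancel.\<close>
  moreover have "exp (w * of_real 1) = 1"
    using e[of 1] e_char_of_int[of m] by simp
  ultimately show ?thesis using False by (simp add: e)
qed

section \<open>Even moments as weighted counts of coincidences\<close>

text \<open>The frequency map \<phi> is kept apart from the index set, so that tuples and pairs can
  index sums in which frequencies repeat.\<close>

definition trig :: "'s set \<Rightarrow> ('s \<Rightarrow> int) \<Rightarrow> ('s \<Rightarrow> complex) \<Rightarrow> real \<Rightarrow> complex" where
  "trig S \<phi> c x = (\<Sum>s\<in>S. c s * e_char (of_int (\<phi> s) * x))"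

lemma continuous_on_trig [continuous_intros]:
  "continuous_on A f \<Longrightarrow> continuous_on A (\<lambda>x. trig S \<phi> c (f x))"
  unfolding trig_def by (intro continuous_intros)

abbreviation tuples :: "nat \<Rightarrow> 's set \<Rightarrow> (nat \<Rightarrow> 's) set" where
  "tuples n S \<equiv> PiE {..<n} (\<lambda>_. S)"

lemma finite_tuples: "finite S \<Longrightarrow> finite (tuples n S)"
  by (rule finite_PiE) auto

text \<open>Expanding the power indexes the sum by tuples; equal frequencies are not collected, so
  the coefficients stay plain products.\<close>

lemma trig_power:
  assumes "finite S"
  shows "trig S \<phi> c x ^ n = trig (tuples n S) (\<lambda>v. \<Sum>i<n. \<phi> (v i)) (\<lambda>v. \<Prod>i<n. c (v i)) x"
proof -
  have "trig S \<phi> c x ^ n = (\<Prod>i<n. \<Sum>s\<in>S. c s * e_char (of_int (\<phi> s) * x))"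
    by (simp add: trig_def)
  also have "\<dots> = (\<Sum>v\<in>tuples n S. \<Prod>i<n. c (v i) * e_char (of_int (\<phi> (v i)) * x))"
    by (rule prod_sum_PiE) (use assms in auto)
  finally show ?thesis
    by (simp add: trig_def prod.distrib sum_distrib_right flip: e_char_sum)
qed

text \<open>A weighted additive energy: for \<open>n\<close>-fold sums of an injective frequency map
  with unit coefficients it counts the solutions of \<open>x_1 + ... + x_n = y_1 + ... + y_n\<close>
  in the frequencies.\<close>

definition energy :: "'t set \<Rightarrow> ('t \<Rightarrow> int) \<Rightarrow> ('t \<Rightarrow> complex) \<Rightarrow> complex" where
  "energy T \<psi> b = (\<Sum>t\<in>T. \<Sum>u\<in>T. if \<psi> t = \<psi> u then b t * cnj (b u) else 0)"

lemma trig_mult_cnj: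
  "trig T \<psi> b x * cnj (trig T \<psi> b x)
     = (\<Sum>t\<in>T. \<Sum>u\<in>T. b t * cnj (b u) * e_char (of_int (\<psi> t - \<psi> u) * x))"
  by (simp add: trig_def cnj_sum sum_product left_diff_distrib right_diff_distrib e_char_diff mult_ac)

text \<open>Orthogonality leaves only pairs of equal frequency; off-diagonal pairs can survive
  because \<psi> may repeat values.\<close>

lemma parseval:
  assumes "finite T"
  shows "((\<lambda>x. trig T \<psi> b x * cnj (trig T \<psi> b x)) has_integral energy T \<psi> b) {0..1}"
proof -
  have "((\<lambda>x. \<Sum>t\<in>T. \<Sum>u\<in>T. b t * cnj (b u) * e_char (of_int (\<psi> t - \<psi> u) * x))
     has_integral (\<Sum>t\<in>T. \<Sum>u\<in>T. b t * cnj (b u) * (if \<psi> t - \<psi> u = 0 then 1 else 0))) {0..1}"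
    by (intro has_integral_sum has_integral_mult_right has_integral_e_char assms)
  moreover have "(\<Sum>t\<in>T. \<Sum>u\<in>T. b t * cnj (b u) * (if \<psi> t - \<psi> u = 0 then 1 else 0))
      = energy T \<psi> b"
    unfolding energy_def by (intro sum.cong) auto
  ultimately show ?thesis by (simp add: trig_mult_cnj)
qed

definition moment :: "nat \<Rightarrow> 's set \<Rightarrow> ('s \<Rightarrow> int) \<Rightarrow> ('s \<Rightarrow> complex) \<Rightarrow> real" where
  "moment n S \<phi> c = integral {0..1} (\<lambda>x. norm (trig S \<phi> c x) ^ (2 * n))"

lemma has_integral_moment:
  "((\<lambda>x. norm (trig S \<phi> c x) ^ (2 * n)) has_integral moment n S \<phi> c) {0..1}"
  unfolding moment_def
  by (intro integrable_integral integrable_continuous_real continuous_intros)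

lemma moment_nonneg: "0 \<le> moment n S \<phi> c"
  by (rule has_integral_nonneg[OF has_integral_moment]) simp

text \<open>\<open>|f| ^ (2 * n)\<close> is the squared modulus of \<open>f ^ n\<close>, which is
  itself a trigonometric sum, so \<open>parseval\<close> applies to it.\<close>

lemma moment_eq_energy:
  assumes "finite S"
  shows "of_real (moment n S \<phi> c)
     = energy (tuples n S) (\<lambda>v. \<Sum>i<n. \<phi> (v i)) (\<lambda>v. \<Prod>i<n. c (v i))"
proof -
  have "((\<lambda>x. complex_of_real (norm (trig S \<phi> c x) ^ (2 * n))) has_integral
          complex_of_real (moment n S \<phi> c)) {0..1}"
    by (intro has_integral_of_real has_integral_moment)
  moreover have "complex_of_real (norm (trig S \<phi> c x) ^ (2 * n))
      = trig S \<phi> c x ^ n * cnj (trig S \<phi> c x ^ n)" for x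
    by (simp only: complex_norm_square[symmetric] norm_power power_mult[symmetric] mult.commute)
  ultimately have "((\<lambda>x. trig S \<phi> c x ^ n * cnj (trig S \<phi> c x ^ n)) has_integral
      complex_of_real (moment n S \<phi> c)) {0..1}"
    by simp
  thus ?thesis
    unfolding trig_power[OF assms] by (rule has_integral_unique[OF _ parseval[OF finite_tuples[OF assms]]])
qed

text \<open>An admissible constant only controls nonnegative coefficients; at even exponents this extends it
  to the complex coefficients of the slices of a two-variable sum.\<close>

lemma moment_le_norm:
  assumes "finite S"
  shows "moment n S \<phi> c \<le> moment n S \<phi> (\<lambda>s. of_real (norm (c s)))"
proof -
  let ?T = "tuples n S" and ?\<psi> = "\<lambda>v. \<Sum>i<n. \<phi> (v i)"
  have "norm (complex_of_real (moment n S \<phi> c))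
     \<le> (\<Sum>t\<in>?T. \<Sum>u\<in>?T. if ?\<psi> t = ?\<psi> u then (\<Prod>i<n. norm (c (t i))) * (\<Prod>i<n. norm (c (u i))) else 0)"
    unfolding moment_eq_energy[OF assms] energy_def
    by (intro sum_norm_le) (simp add: norm_mult flip: prod_norm)
  moreover have "complex_of_real (\<Sum>t\<in>?T. \<Sum>u\<in>?T. if ?\<psi> t = ?\<psi> u then
        (\<Prod>i<n. norm (c (t i))) * (\<Prod>i<n. norm (c (u i))) else 0)
      = of_real (moment n S \<phi> (\<lambda>s. of_real (norm (c s))))"
    unfolding moment_eq_energy[OF assms] energy_def of_real_sum
    by (intro sum.cong) auto
  ultimately show ?thesis
    using moment_nonneg[of n S \<phi> c] by (simp del: of_real_sum)
qed

section \<open>Separation of digits without carryover\<close>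

lemma digit_unique:
  fixes q r s r' s' :: int
  assumes "0 \<le> r" "r < q" "0 \<le> r'" "r' < q"
  shows "r + q * s = r' + q * s' \<longleftrightarrow> r = r' \<and> s = s'"
proof
  assume *: "r + q * s = r' + q * s'"
  have "r = (r + q * s) mod q" using assms by simp
  also have "\<dots> = r'" unfolding * using assms by simp
  finally show "r = r' \<and> s = s'" using * assms by auto
qed simp

text \<open>The integral inside the inner moment detects coincidences of the sums of first
  coordinates, the integral over \<open>y\<close> those of second coordinates. Without carryover
  both together amount to a coincidence of the sums of \<open>a + q * b\<close>, so the two energies
  agree.\<close>

lemma moment_separate:
  fixes A B :: "int set" and c :: "int \<times> int \<Rightarrow> complex"
  assumes fin: "finite A" "finite B"
    and digits: "\<And>a. a \<in> A \<Longrightarrow> 0 \<le> a \<and> int n * a < q" and n: "n \<ge> 1"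
  shows "((\<lambda>y. moment n A id (\<lambda>a. trig B id (\<lambda>b. c (a, b)) y)) has_integral
            moment n (A \<times> B) (\<lambda>(a, b). a + q * b) c) {0..1}"
proof -
  let ?S = "A \<times> B" and ?\<phi> = "\<lambda>(a, b). a + q * b"
  let ?T = "tuples n ?S"
  let ?\<psi>1 = "\<lambda>v. \<Sum>i<n. fst (v i) :: int" and ?\<psi>2 = "\<lambda>v. \<Sum>i<n. snd (v i) :: int"
  let ?b = "\<lambda>v. \<Prod>i<n. c (v i)"
  have finS: "finite ?S" using fin by auto
  have finT: "finite ?T" by (rule finite_tuples[OF finS])
  have bnd: "0 \<le> ?\<psi>1 v \<and> ?\<psi>1 v < q" if "v \<in> ?T" for v
  proof -
    have v: "fst (v i) \<in> A" if "i < n" for i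
      using PiE_mem[OF \<open>v \<in> ?T\<close>, of i] that by auto
    \<comment> \<open>Adding \<open>int n * a < q\<close> over the \<open>n\<close> entries gives
      \<open>n\<close> times the sum below \<open>n * q\<close>; strictness needs at least one
      entry.\<close>
    have "int n * ?\<psi>1 v = (\<Sum>i<n. int n * fst (v i))" by (simp add: sum_distrib_left)
    also have "\<dots> < (\<Sum>i<n. q)" by (rule sum_strict_mono) (use v digits n in \<open>auto simp: lessThan_empty_iff\<close>)
    finally have "?\<psi>1 v < q" using n by simp
    moreover have "0 \<le> ?\<psi>1 v" by (rule sum_nonneg) (use v digits in auto)
    ultimately show ?thesis by blast
  qed
  have sep: "?\<psi>1 t + q * ?\<psi>2 t = ?\<psi>1 u + q * ?\<psi>2 u \<longleftrightarrow> ?\<psi>1 t = ?\<psi>1 u \<and> ?\<psi>2 t = ?\<psi>2 u"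
    if "t \<in> ?T" "u \<in> ?T" for t u
    using bnd[OF that(1)] bnd[OF that(2)] by (intro digit_unique) auto
  \<comment> \<open>For fixed \<open>y\<close> the iterated sum runs over
    \<open>A \<times> B\<close> with a frequency that ignores \<open>b\<close>; the phase in
    \<open>y\<close> moves into the coefficients.\<close>
  have slice: "trig A id (\<lambda>a. trig B id (\<lambda>b. c (a, b)) y) x
      = trig ?S fst (\<lambda>s. c s * e_char (of_int (snd s) * y)) x" for x y
    unfolding trig_def by (simp add: sum.cartesian_product sum_distrib_right case_prod_unfold)
  have moment_slice: "complex_of_real (moment n A id (\<lambda>a. trig B id (\<lambda>b. c (a, b)) y))
     = (\<Sum>t\<in>?T. \<Sum>u\<in>?T. (if ?\<psi>1 t = ?\<psi>1 u then ?b t * cnj (?b u) else 0)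
           * e_char (of_int (?\<psi>2 t - ?\<psi>2 u) * y))" for y
  proof -
    have "moment n A id (\<lambda>a. trig B id (\<lambda>b. c (a, b)) y)
        = moment n ?S fst (\<lambda>s. c s * e_char (of_int (snd s) * y))"
      unfolding moment_def slice ..
    moreover have "(\<Prod>i<n. c (t i) * e_char (of_int (snd (t i)) * y)) = ?b t * e_char (of_int (?\<psi>2 t) * y)" for t
      by (simp add: prod.distrib sum_distrib_right flip: e_char_sum)
    moreover have "e_char (of_int (r - s) * y) = e_char (of_int r * y) * cnj (e_char (of_int s * y))"
      for r s :: int
      by (simp add: left_diff_distrib e_char_diff)
    ultimately show ?thesis
      by (simp only: moment_eq_energy[OF finS] energy_def complex_cnj_mult)
         (intro sum.cong refl, simp add: mult_ac del: cnj_prod)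
  qed
  have "((\<lambda>y. complex_of_real (moment n A id (\<lambda>a. trig B id (\<lambda>b. c (a, b)) y))) has_integral
     (\<Sum>t\<in>?T. \<Sum>u\<in>?T. (if ?\<psi>1 t = ?\<psi>1 u then ?b t * cnj (?b u) else 0)
           * (if ?\<psi>2 t - ?\<psi>2 u = 0 then 1 else 0))) {0..1}"
    unfolding moment_slice
    by (intro has_integral_sum has_integral_mult_right has_integral_e_char finT)
  also have "(\<Sum>t\<in>?T. \<Sum>u\<in>?T. (if ?\<psi>1 t = ?\<psi>1 u then ?b t * cnj (?b u) else 0)
           * (if ?\<psi>2 t - ?\<psi>2 u = 0 then 1 else 0))
      = (\<Sum>t\<in>?T. \<Sum>u\<in>?T. if ?\<psi>1 t + q * ?\<psi>2 t = ?\<psi>1 u + q * ?\<psi>2 u then ?b t * cnj (?b u) else 0)"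
    by (intro sum.cong refl) (auto simp: sep)
  also have "\<dots> = complex_of_real (moment n ?S ?\<phi> c)"
    by (simp add: moment_eq_energy[OF finS] energy_def case_prod_unfold sum.distrib sum_distrib_left)
  finally have "((Re \<circ> (\<lambda>y. complex_of_real (moment n A id (\<lambda>a. trig B id (\<lambda>b. c (a, b)) y))))
      has_integral Re (complex_of_real (moment n ?S ?\<phi> c))) {0..1}"
    by (rule has_integral_linear[OF _ bounded_linear_Re])
  thus ?thesis by (simp add: o_def)
qed

section \<open>A weighted power mean inequality\<close>

lemma convex_on_power_nonneg: "convex_on {0..} (\<lambda>x::real. x ^ n)"
proof (cases "even n")
  case True
  thus ?thesis using convex_power_even[of n] convex_on_subset by blast
qed (rule convex_power_odd)

text \<open>Jensen's inequality for \<open>t ^ Suc m\<close> with the weights \<open>s\<close>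
  divided by their total; clearing denominators produces the factor with exponent
  \<open>m\<close>.\<close>

lemma weighted_power_mean:
  fixes s h :: "'a \<Rightarrow> real"
  assumes "finite A" "\<And>a. a \<in> A \<Longrightarrow> 0 \<le> s a" "\<And>a. a \<in> A \<Longrightarrow> 0 \<le> h a"
  shows "(\<Sum>a\<in>A. s a * h a) ^ Suc m \<le> (\<Sum>a\<in>A. s a) ^ m * (\<Sum>a\<in>A. s a * h a ^ Suc m)"
proof (cases "(\<Sum>a\<in>A. s a) = 0")
  case True
  hence "\<forall>a\<in>A. s a = 0" using assms by (simp add: sum_nonneg_eq_0_iff)
  thus ?thesis by simp
next
  case False
  define W where "W = (\<Sum>a\<in>A. s a)"
  have W: "W > 0" using False assms unfolding W_def by (simp add: order_less_le sum_nonneg)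
  have ne: "A \<noteq> {}" using False by auto
  have "(\<Sum>a\<in>A. (s a / W) *\<^sub>R h a) ^ Suc m \<le> (\<Sum>a\<in>A. (s a / W) * h a ^ Suc m)"
    by (rule convex_on_sum[OF assms(1) ne convex_on_power_nonneg])
       (use assms W in \<open>auto simp: W_def simp flip: sum_divide_distrib\<close>)
  hence "((\<Sum>a\<in>A. s a * h a) / W) ^ Suc m \<le> (\<Sum>a\<in>A. s a * h a ^ Suc m) / W"
    by (simp add: sum_divide_distrib)
  hence "(\<Sum>a\<in>A. s a * h a) ^ Suc m / W ^ Suc m * W ^ Suc m
      \<le> (\<Sum>a\<in>A. s a * h a ^ Suc m) / W * W ^ Suc m"
    unfolding power_divide using W by (intro mult_right_mono) auto
  thus ?thesis using W by (simp add: W_def[symmetric] mult_ac)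
qed

section \<open>Best constants as bounds on moments\<close>

text \<open>This is \<open>admissible_const\<close> raised to the power \<open>2 * n\<close>, which
  removes the roots, and with a frequency map, so that coefficients can live on
  \<open>A \<times> B\<close> instead of its image.\<close>

definition moment_bound :: "nat \<Rightarrow> 's set \<Rightarrow> ('s \<Rightarrow> int) \<Rightarrow> real \<Rightarrow> bool" where
  "moment_bound n S \<phi> C \<longleftrightarrow> 0 \<le> C \<and>
     (\<forall>a :: 's \<Rightarrow> real. (\<forall>s\<in>S. 0 \<le> a s) \<longrightarrow>
        moment n S \<phi> (\<lambda>s. of_real (a s)) \<le> C ^ (2 * n) * (\<Sum>s\<in>S. (a s)\<^sup>2) ^ n)"

lemma Lp_norm_cube_trig:
  assumes "n \<ge> 1"
  shows "Lp_norm_cube (2 * real n) (trig S \<phi> c) ^ (2 * n) = moment n S \<phi> c"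
proof -
  have cb: "cbox 0 One = {0..1::real}" by (simp add: box_real)
  \<comment> \<open>At norm zero the two powers agree only for a nonzero exponent:
    \<open>0 powr 0 = 0\<close>, but \<open>0 ^ 0 = 1\<close>.\<close>
  have eq: "norm (trig S \<phi> c x) powr (2 * real n) = norm (trig S \<phi> c x) ^ (2 * n)" for x
    using powr_realpow'[of "norm (trig S \<phi> c x)" "2 * n"] assms by simp
  have "set_integrable lborel {0..1::real} (\<lambda>x. norm (trig S \<phi> c x) ^ (2 * n))"
    unfolding set_integrable_def
    by (rule borel_integrable_compact) (auto intro!: continuous_intros)
  hence "(LINT x:{0..1}|lborel. norm (trig S \<phi> c x) ^ (2 * n)) = moment n S \<phi> c"
    unfolding moment_def by (rule set_borel_integral_eq_integral)
  hence "Lp_norm_cube (2 * real n) (trig S \<phi> c) = moment n S \<phi> c powr (1 / (2 * real n))"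
    unfolding Lp_norm_cube_def cb eq by simp
  moreover have "(moment n S \<phi> c powr (1 / (2 * real n))) ^ (2 * n) = moment n S \<phi> c"
    using assms moment_nonneg[of n S \<phi> c]
    by (subst powr_realpow'[symmetric]) (auto simp: powr_powr)
  ultimately show ?thesis by simp
qed

text \<open>Injectivity lets coefficients on the frequencies be reindexed by \<open>S\<close>; both
  sides of the norm inequality are nonnegative, so raising them to the power \<open>2 * n\<close>
  loses nothing.\<close>

lemma admissible_const_image:
  fixes \<phi> :: "'s \<Rightarrow> int"
  assumes n: "n \<ge> 1" and inj: "inj_on \<phi> S"
  shows "admissible_const (2 * real n) (real_of_int ` \<phi> ` S) C \<longleftrightarrow> moment_bound n S \<phi> C"
proof -
  let ?\<psi> = "\<lambda>s. real_of_int (\<phi> s)"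
  have inj': "inj_on ?\<psi> S" using inj by (auto simp: inj_on_def)
  have im: "real_of_int ` \<phi> ` S = ?\<psi> ` S" by auto
  let ?N = "\<lambda>a. Lp_norm_cube (2 * real n) (trig S \<phi> (\<lambda>s. complex_of_real (a s)))"
  have *: "Lp_norm_cube (2 * real n) (\<lambda>x. \<Sum>l\<in>?\<psi> ` S. complex_of_real (a l) * e_char (l \<bullet> x))
      = ?N (\<lambda>s. a (?\<psi> s))" for a
    using inj' by (simp add: sum.reindex trig_def[abs_def])
  have sq: "(\<Sum>l\<in>?\<psi> ` S. \<bar>a l\<bar>\<^sup>2) = (\<Sum>s\<in>S. (a (?\<psi> s))\<^sup>2)"
    for a :: "real \<Rightarrow> real"
    using inj' by (simp add: sum.reindex)
  have iff: "?N a \<le> C * (\<Sum>s\<in>S. (a s)\<^sup>2) powr (1 / 2)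
      \<longleftrightarrow> moment n S \<phi> (\<lambda>s. of_real (a s)) \<le> C ^ (2 * n) * (\<Sum>s\<in>S. (a s)\<^sup>2) ^ n"
    if "0 \<le> C" for a
  proof -
    let ?X = "\<Sum>s\<in>S. (a s)\<^sup>2"
    have X: "0 \<le> ?X" by (rule sum_nonneg) simp
    have "(C * ?X powr (1 / 2)) ^ (2 * n) = C ^ (2 * n) * ?X ^ n"
      using X by (simp add: power_mult_distrib powr_half_sqrt power_mult)
    moreover have "?N a \<ge> 0" by (simp add: Lp_norm_cube_def)
    ultimately show ?thesis
      using that n Lp_norm_cube_trig[OF n, of S \<phi> "\<lambda>s. of_real (a s)"]
        power_mono_iff[of "?N a" "C * ?X powr (1 / 2)" "2 * n"] by simp
  qed
  \<comment> \<open>Every coefficient function on \<open>S\<close> is the pullback of one on the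
    reals, up to values outside \<open>S\<close>, which \<open>P\<close> must not see.\<close>
  have extend: "(\<forall>a. (\<forall>l\<in>?\<psi> ` S. 0 \<le> a l) \<longrightarrow> P (\<lambda>s. a (?\<psi> s)))
      \<longleftrightarrow> (\<forall>a. (\<forall>s\<in>S. 0 \<le> a s) \<longrightarrow> P a)"
    if P: "\<And>a b. (\<And>s. s \<in> S \<Longrightarrow> a s = b s) \<Longrightarrow> P a \<longleftrightarrow> P b" for P :: "('s \<Rightarrow> real) \<Rightarrow> bool"
  proof (intro iffI allI impI)
    fix a :: "'s \<Rightarrow> real"
    assume H: "\<forall>a. (\<forall>l\<in>?\<psi> ` S. 0 \<le> a l) \<longrightarrow> P (\<lambda>s. a (?\<psi> s))" and a: "\<forall>s\<in>S. 0 \<le> a s"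
    have inv: "inv_into S ?\<psi> (?\<psi> s) = s" if "s \<in> S" for s
      using inv_into_f_f[OF inj' that] .
    have "P (\<lambda>s. a (inv_into S ?\<psi> (?\<psi> s)))"
      by (rule H[rule_format, of "\<lambda>l. a (inv_into S ?\<psi> l)"]) (use a inv in auto)
    moreover have "P (\<lambda>s. a (inv_into S ?\<psi> (?\<psi> s))) \<longleftrightarrow> P a"
      by (intro P) (simp add: inv)
    ultimately show "P a" by blast
  qed auto
  let ?P = "\<lambda>a :: 's \<Rightarrow> real. moment n S \<phi> (\<lambda>s. of_real (a s)) \<le> C ^ (2 * n) * (\<Sum>s\<in>S. (a s)\<^sup>2) ^ n"
  have "?P a \<longleftrightarrow> ?P b" if "\<And>s. s \<in> S \<Longrightarrow> a s = b s" for a b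
    using that by (simp add: moment_def trig_def)
  note ext = extend[of ?P, OF this]
  show ?thesis
    unfolding admissible_const_def moment_bound_def im * sq
    using iff ext by auto
qed

lemma moment_bound_complex:
  assumes "moment_bound n S \<phi> C" "finite S"
  shows "moment n S \<phi> c \<le> C ^ (2 * n) * (\<Sum>s\<in>S. (norm (c s))\<^sup>2) ^ n"
  using moment_le_norm[OF assms(2), of n \<phi> c] assms(1) unfolding moment_bound_def
  by (meson norm_ge_zero order_trans)

section \<open>Multiplicativity of the best constant\<close>

text \<open>The slices \<open>G a\<close> are combined by Jensen's inequality with weights \<open>s a\<close>, a form of Minkowski's
  inequality; where \<open>s a = 0\<close> also \<open>G a = 0\<close>, so the junk quotients there vanish.\<close>

lemma moment_bound_product:
  fixes A B :: "int set"
  assumes fin: "finite A" "finite B"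
    and digits: "\<And>a. a \<in> A \<Longrightarrow> 0 \<le> a \<and> int n * a < q" and n: "n \<ge> 1"
    and KA: "moment_bound n A id KA" and KB: "moment_bound n B id KB"
  shows "moment_bound n (A \<times> B) (\<lambda>(a, b). a + q * b) (KA * KB)"
  unfolding moment_bound_def
proof (intro conjI allI impI)
  show "0 \<le> KA * KB" using KA KB by (simp add: moment_bound_def)
  fix c :: "int \<times> int \<Rightarrow> real" assume c: "\<forall>s\<in>A \<times> B. 0 \<le> c s"
  obtain m where m: "n = Suc m" using n by (cases n) auto
  let ?c = "\<lambda>s. complex_of_real (c s)"
  define G where "G = (\<lambda>a. trig B id (\<lambda>b. ?c (a, b)))"
  define s where "s a = (\<Sum>b\<in>B. (c (a, b))\<^sup>2)" for a
  define W where "W = (\<Sum>a\<in>A. s a)"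
  have s0: "0 \<le> s a" for a unfolding s_def by (rule sum_nonneg) simp
  have G0: "G a y = 0" if "s a = 0" for a y
  proof -
    have "\<forall>b\<in>B. c (a, b) = 0" using that fin by (simp add: s_def sum_nonneg_eq_0_iff)
    thus ?thesis by (simp add: G_def trig_def)
  qed
  have slice: "moment n A id (\<lambda>a. G a y)
      \<le> KA ^ (2 * n) * (W ^ m * (\<Sum>a\<in>A. norm (G a y) ^ (2 * n) / s a ^ m))" for y
  proof -
    have "moment n A id (\<lambda>a. G a y) \<le> KA ^ (2 * n) * (\<Sum>a\<in>A. (norm (G a y))\<^sup>2) ^ n"
      by (rule moment_bound_complex[OF KA fin(1)])
    \<comment> \<open>The weight \<open>s a\<close> is multiplied in and divided out to prepare the
      power mean; the total weight \<open>W\<close> is the sum of all squared coefficients.\<close>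
    also have "(\<Sum>a\<in>A. (norm (G a y))\<^sup>2) = (\<Sum>a\<in>A. s a * ((norm (G a y))\<^sup>2 / s a))"
      by (intro sum.cong refl) (auto simp: G0)
    also have "\<dots> ^ n \<le> W ^ m * (\<Sum>a\<in>A. s a * ((norm (G a y))\<^sup>2 / s a) ^ n)"
      unfolding m W_def by (rule weighted_power_mean) (use fin s0 in auto)
    also have "(\<Sum>a\<in>A. s a * ((norm (G a y))\<^sup>2 / s a) ^ n) = (\<Sum>a\<in>A. norm (G a y) ^ (2 * n) / s a ^ m)"
      by (intro sum.cong refl) (auto simp: G0 m power_divide power_mult field_simps power2_eq_square power_mult_distrib)
    finally show ?thesis by (simp add: mult_left_mono id_def)
  qed
  have "moment n (A \<times> B) (\<lambda>(a, b). a + q * b) ?c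
     \<le> KA ^ (2 * n) * (W ^ m * (\<Sum>a\<in>A. moment n B id (\<lambda>b. ?c (a, b)) / s a ^ m))"
  proof (rule has_integral_le)
    show "((\<lambda>y. moment n A id (\<lambda>a. G a y)) has_integral moment n (A \<times> B) (\<lambda>(a, b). a + q * b) ?c) {0..1}"
      unfolding G_def by (rule moment_separate[OF fin digits n])
    show "((\<lambda>y. KA ^ (2 * n) * (W ^ m * (\<Sum>a\<in>A. norm (G a y) ^ (2 * n) / s a ^ m))) has_integral
        KA ^ (2 * n) * (W ^ m * (\<Sum>a\<in>A. moment n B id (\<lambda>b. ?c (a, b)) / s a ^ m))) {0..1}"
      unfolding G_def by (intro has_integral_mult_right has_integral_sum has_integral_divide has_integral_moment fin)
  qed (rule slice)
  \<comment> \<open>Row \<open>a\<close> has squared norm \<open>s a\<close>, so \<open>KB\<close>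
    bounds its moment by \<open>KB ^ (2 * n) * s a ^ Suc m\<close>; the division leaves one factor
    \<open>s a\<close>, and these add up to \<open>W\<close>.\<close>
  also have "\<dots> \<le> KA ^ (2 * n) * (W ^ m * (\<Sum>a\<in>A. KB ^ (2 * n) * s a))"
  proof (intro mult_left_mono sum_mono)
    fix a assume "a \<in> A"
    hence *: "moment n B id (\<lambda>b. ?c (a, b)) \<le> KB ^ (2 * n) * s a ^ n"
      using KB c unfolding moment_bound_def s_def by auto
    show "moment n B id (\<lambda>b. ?c (a, b)) / s a ^ m \<le> KB ^ (2 * n) * s a"
    proof (cases "s a = 0")
      \<comment> \<open>For \<open>m = 0\<close> the divisor is 1 even here, so the moment itself
        has to vanish.\<close>
      case True
      hence "moment n B id (\<lambda>b. ?c (a, b)) = 0"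
        using * m moment_nonneg[of n B id "\<lambda>b. ?c (a, b)"] by simp
      thus ?thesis using True by simp
    next
      case False
      thus ?thesis using * s0[of a] by (simp add: m divide_le_eq mult_ac)
    qed
  qed (auto simp: W_def s0 sum_nonneg)
  also have "\<dots> = (KA * KB) ^ (2 * n) * W ^ n"
    by (simp add: m W_def power_mult_distrib sum_distrib_left[symmetric])
  also have "W = (\<Sum>s\<in>A \<times> B. (c s)\<^sup>2)"
    by (simp add: W_def s_def sum.cartesian_product)
  finally show "moment n (A \<times> B) (\<lambda>(a, b). a + q * b) ?c
      \<le> (KA * KB) ^ (2 * n) * (\<Sum>s\<in>A \<times> B. (c s)\<^sup>2) ^ n" .
qed

text \<open>At each \<open>y\<close> the slice is \<open>u\<close> scaled by the sum over
  \<open>B\<close>, so the inner moment is a constant times a power whose integral is the other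
  moment.\<close>

lemma moment_tensor:
  fixes A B :: "int set"
  assumes fin: "finite A" "finite B"
    and digits: "\<And>a. a \<in> A \<Longrightarrow> 0 \<le> a \<and> int n * a < q" and n: "n \<ge> 1"
  shows "moment n (A \<times> B) (\<lambda>(a, b). a + q * b) (\<lambda>(a, b). u a * v b) = moment n A id u * moment n B id v"
proof -
  have "moment n A id (\<lambda>a. trig B id (\<lambda>b. u a * v b) y) = moment n A id u * norm (trig B id v y) ^ (2 * n)" for y
  proof -
    have "trig A id (\<lambda>a. trig B id (\<lambda>b. u a * v b) y) x = trig A id u x * trig B id v y" for x
      unfolding trig_def sum_product by (simp add: sum_distrib_left sum_distrib_right mult_ac)
    thus ?thesis by (simp add: moment_def norm_mult power_mult_distrib)
  qed
  hence "((\<lambda>y. moment n A id u * norm (trig B id v y) ^ (2 * n)) has_integral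
      moment n (A \<times> B) (\<lambda>(a, b). a + q * b) (\<lambda>(a, b). u a * v b)) {0..1}"
    using moment_separate[OF fin digits n, of "\<lambda>(a, b). u a * v b"] by simp
  moreover have "((\<lambda>y. moment n A id u * norm (trig B id v y) ^ (2 * n)) has_integral
      moment n A id u * moment n B id v) {0..1}"
    by (intro has_integral_mult_right has_integral_moment)
  ultimately show ?thesis by (rule has_integral_unique)
qed

text \<open>This serves the lower bound: \<open>r\<close> carries the contribution of one fixed
  tensor factor, and minimality of the best constant is then applied to
  \<open>C / r\<close>.\<close>

lemma moment_bound_divide:
  assumes "n \<ge> 1" "0 \<le> C" "0 < r"
    and "\<And>a :: 's \<Rightarrow> real. (\<forall>s\<in>S. 0 \<le> a s) \<Longrightarrow>
        r ^ (2 * n) * moment n S \<phi> (\<lambda>s. of_real (a s)) \<le> C ^ (2 * n) * (\<Sum>s\<in>S. (a s)\<^sup>2) ^ n"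
  shows "moment_bound n S \<phi> (C / r)"
  using assms unfolding moment_bound_def by (simp add: power_divide pos_le_divide_eq mult_ac)

text \<open>\<open>KA * KB\<close> is a moment bound for the product, hence at least
  \<open>K\<close>. Conversely \<open>K\<close> is tested on tensor products, and minimality is used
  twice: for \<open>KA\<close> with \<open>v\<close> fixed, then for \<open>KB\<close>.\<close>

lemma best_const_product:
  fixes A B :: "int set"
  assumes fin: "finite A" "finite B"
    and digits: "\<And>a. a \<in> A \<Longrightarrow> 0 \<le> a \<and> int n * a < q" and n: "n \<ge> 1"
  shows "best_const (2 * real n) (real_of_int ` (\<lambda>(a, b). a + q * b) ` (A \<times> B))
      = best_const (2 * real n) (real_of_int ` A) * best_const (2 * real n) (real_of_int ` B)"
proof -
  let ?\<phi> = "\<lambda>(a, b). a + q * b"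
  define K KA KB where "K = best_const (2 * real n) (real_of_int ` ?\<phi> ` (A \<times> B))"
    and "KA = best_const (2 * real n) (real_of_int ` A)"
    and "KB = best_const (2 * real n) (real_of_int ` B)"
  have "a < q" if "a \<in> A" for a
  proof -
    have "1 * a \<le> int n * a" using digits[OF that] n by (intro mult_right_mono) auto
    thus ?thesis using digits[OF that] by simp
  qed
  hence inj: "inj_on ?\<phi> (A \<times> B)"
    using digits by (auto simp: inj_on_def digit_unique)
  have p: "0 < 2 * real n" using n by simp
  note least = best_const_least[OF finite_imageI p]
  have adm: "admissible_const (2 * real n) (real_of_int ` T) C \<longleftrightarrow> moment_bound n T id C" for T C
    using admissible_const_image[OF n inj_on_id, of T] by simp
  have mA: "moment_bound n A id KA" and lA: "\<And>C. moment_bound n A id C \<Longrightarrow> KA \<le> C"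
    using least[OF fin(1), of real_of_int] unfolding adm KA_def by blast+
  have mB: "moment_bound n B id KB" and lB: "\<And>C. moment_bound n B id C \<Longrightarrow> KB \<le> C"
    using least[OF fin(2), of real_of_int] unfolding adm KB_def by blast+
  have mK: "moment_bound n (A \<times> B) ?\<phi> K" and lK: "\<And>C. moment_bound n (A \<times> B) ?\<phi> C \<Longrightarrow> K \<le> C"
    using least[of "?\<phi> ` (A \<times> B)" real_of_int] fin
    unfolding admissible_const_image[OF n inj] K_def by auto
  have nonneg: "0 \<le> KA" "0 \<le> KB" "0 \<le> K" using mA mB mK by (auto simp: moment_bound_def)
  have tensor: "moment n A id (\<lambda>s. of_real (u s)) * moment n B id (\<lambda>s. of_real (v s))
      \<le> K ^ (2 * n) * ((\<Sum>a\<in>A. (u a)\<^sup>2) ^ n * (\<Sum>b\<in>B. (v b)\<^sup>2) ^ n)"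
    if "\<forall>a\<in>A. 0 \<le> u a" "\<forall>b\<in>B. 0 \<le> v b" for u v :: "int \<Rightarrow> real"
  proof -
    have "moment n (A \<times> B) ?\<phi> (\<lambda>s. of_real ((\<lambda>(a, b). u a * v b) s))
        \<le> K ^ (2 * n) * (\<Sum>s\<in>A \<times> B. ((\<lambda>(a, b). u a * v b) s)\<^sup>2) ^ n"
      using mK[unfolded moment_bound_def, THEN conjunct2, rule_format, of "\<lambda>(a, b). u a * v b"] that by auto
    moreover have "(\<Sum>s\<in>A \<times> B. ((\<lambda>(a, b). u a * v b) s)\<^sup>2) = (\<Sum>a\<in>A. (u a)\<^sup>2) * (\<Sum>b\<in>B. (v b)\<^sup>2)"
      by (simp add: sum_product sum.cartesian_product case_prod_unfold power_mult_distrib)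
    moreover have "(\<lambda>s. complex_of_real ((\<lambda>(a, b). u a * v b) s)) = (\<lambda>(a, b). of_real (u a) * of_real (v b))"
      by auto
    ultimately show ?thesis
      using moment_tensor[OF fin digits n, of "\<lambda>s. of_real (u s)" "\<lambda>s. of_real (v s)"]
      by (simp add: power_mult_distrib)
  qed
  have "K \<le> KA * KB"
    by (rule lK, rule moment_bound_product[OF fin digits n mA mB])
  moreover have "KA * KB \<le> K"
  proof (cases "KA = 0")
    case True
    thus ?thesis using nonneg by simp
  next
    case False
    hence KA: "KA > 0" using nonneg by simp
    have "KA ^ (2 * n) * moment n B id (\<lambda>s. of_real (v s)) \<le> K ^ (2 * n) * (\<Sum>b\<in>B. (v b)\<^sup>2) ^ n"
      if v: "\<forall>b\<in>B. 0 \<le> v b" for v :: "int \<Rightarrow> real"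
    proof -
      let ?M = "moment n B id (\<lambda>s. of_real (v s))" and ?X = "\<Sum>b\<in>B. (v b)\<^sup>2"
      have X: "0 \<le> ?X" by (rule sum_nonneg) simp
      \<comment> \<open>The root makes the fixed moment a power \<open>r ^ (2 * n)\<close>, as
        \<open>moment_bound_divide\<close> expects.\<close>
      define r where "r = root (2 * n) ?M"
      have r: "r ^ (2 * n) = ?M" using n moment_nonneg unfolding r_def by (intro real_root_pow_pos2) auto
      have r0: "0 \<le> r" using n moment_nonneg unfolding r_def by simp
      have s: "(K * sqrt ?X) ^ (2 * n) = K ^ (2 * n) * ?X ^ n"
        using X by (simp add: power_mult_distrib power_mult)
      have "KA * r \<le> K * sqrt ?X"
      proof (cases "r = 0")
        case True
        thus ?thesis using nonneg X by simp
      next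
        case False
        \<comment> \<open>Read for fixed \<open>v\<close> and all \<open>u\<close>,
          \<open>tensor\<close> says that the right-hand side is a moment bound for
          \<open>A\<close>.\<close>
        have "KA \<le> K * sqrt ?X / r"
        proof (rule lA, rule moment_bound_divide[OF n])
          fix u :: "int \<Rightarrow> real" assume "\<forall>a\<in>A. 0 \<le> u a"
          from tensor[OF this v]
          show "r ^ (2 * n) * moment n A id (\<lambda>s. of_real (u s))
              \<le> (K * sqrt ?X) ^ (2 * n) * (\<Sum>a\<in>A. (u a)\<^sup>2) ^ n"
            unfolding r s by (simp add: mult_ac)
        qed (use False r0 nonneg X in auto)
        thus ?thesis using False r0 by (simp add: pos_le_divide_eq)
      qed
      hence "(KA * r) ^ (2 * n) \<le> (K * sqrt ?X) ^ (2 * n)"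
        using nonneg r0 by (intro power_mono) auto
      thus ?thesis unfolding s by (simp add: power_mult_distrib r)
    qed
    \<comment> \<open>Now \<open>v\<close> varies, and \<open>KA\<close> plays the part of the fixed
      factor.\<close>
    hence "KB \<le> K / KA"
      by (intro lB moment_bound_divide n nonneg KA)
    thus ?thesis using KA by (simp add: pos_le_divide_eq mult_ac)
  qed
  ultimately show ?thesis unfolding K_def KA_def KB_def by simp
qed

section \<open>Splitting off one digit\<close>

lemma ellipsephic_level_1: "ellipsephic_level q D 1 = D"
proof (intro equalityI subsetI)
  fix x assume "x \<in> D"
  thus "x \<in> ellipsephic_level q D 1"
    unfolding ellipsephic_level_def by (auto intro!: exI[of _ "\<lambda>_. x"])
qed (auto simp: ellipsephic_level_def)

text \<open>The lowest digit is split off, since \<open>best_const_product\<close> needs small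
  elements only in its first factor.\<close>

lemma ellipsephic_level_Suc:
  "ellipsephic_level q D (Suc j) = (\<lambda>(a, b). a + q * b) ` (D \<times> ellipsephic_level q D j)"
proof (intro equalityI subsetI)
  fix x assume "x \<in> ellipsephic_level q D (Suc j)"
  then obtain a where a: "x = (\<Sum>s<Suc j. a s * q ^ s)" "\<forall>s<Suc j. a s \<in> D"
    by (auto simp: ellipsephic_level_def)
  have "x = a 0 + q * (\<Sum>s<j. a (Suc s) * q ^ s)"
    unfolding a(1) sum.lessThan_Suc_shift by (simp add: sum_distrib_left mult_ac)
  moreover have "(\<Sum>s<j. a (Suc s) * q ^ s) \<in> ellipsephic_level q D j"
    using a(2) unfolding ellipsephic_level_def by (auto intro!: exI[of _ "\<lambda>s. a (Suc s)"])
  ultimately show "x \<in> (\<lambda>(a, b). a + q * b) ` (D \<times> ellipsephic_level q D j)"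
    using a(2) by auto
next
  fix x assume "x \<in> (\<lambda>(a, b). a + q * b) ` (D \<times> ellipsephic_level q D j)"
  then obtain c a where x: "x = c + q * (\<Sum>s<j. a s * q ^ s)" "c \<in> D" "\<forall>s<j. a s \<in> D"
    by (auto simp: ellipsephic_level_def)
  \<comment> \<open>\<open>case_nat c a\<close> puts \<open>c\<close> at weight \<open>q ^ 0\<close>
    and shifts the other digits up.\<close>
  have "x = (\<Sum>s<Suc j. case_nat c a s * q ^ s)"
    unfolding x(1) sum.lessThan_Suc_shift by (simp add: sum_distrib_left mult_ac)
  moreover have "\<forall>s<Suc j. case_nat c a s \<in> D"
    using x by (auto split: nat.split)
  ultimately show "x \<in> ellipsephic_level q D (Suc j)"
    unfolding ellipsephic_level_def by blast
qed

theorem proposition1p2: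
  fixes n j k :: nat and q :: int and d :: "nat \<Rightarrow> int"
  assumes "n \<ge> 1" and "j \<ge> 1" and "k \<ge> 1"
    and "0 \<le> d 1" and "strict_mono_on {1..k} d" and "d k < q"
    and no_carryover: "int n * d k < q"
  shows "best_const (2 * real n) (real_of_int ` ellipsephic_level q (d ` {1..k}) j)
       = best_const (2 * real n) (real_of_int ` ellipsephic_level q (d ` {1..k}) 1) ^ j"
  using \<open>j \<ge> 1\<close>
proof (induction j rule: nat_induct_at_least)
  case base
  show ?case by simp
next
  case (Suc j)
  let ?D = "d ` {1..k}"
  have mono: "mono_on {1..k} d" using assms(5) by (rule strict_mono_on_imp_mono_on)
  have digits: "0 \<le> a \<and> int n * a < q" if "a \<in> ?D" for a
  proof -
    from that obtain i where i: "a = d i" "i \<in> {1..k}" by blast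
    \<comment> \<open>Monotonicity reduces the carryover condition to the largest digit
      \<open>d k\<close>.\<close>
    have "d 1 \<le> a" "a \<le> d k" using i by (auto intro!: mono_onD[OF mono])
    moreover from this(2) have "int n * a \<le> int n * d k" by (intro mult_left_mono) auto
    ultimately show ?thesis using assms(4) no_carryover by linarith
  qed
  show ?case
    \<comment> \<open>The induction hypothesis is used from right to left, turning the
      \<open>j\<close>-th power back into the constant of level \<open>j\<close>.\<close>
    unfolding ellipsephic_level_Suc[of q ?D j] power_Suc Suc.IH[symmetric]
    unfolding ellipsephic_level_1
    by (rule best_const_product) (use digits assms(1) in \<open>auto intro: finite_ellipsephic_level\<close>)
qed

end
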